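(* Let $c>0$ and $\ell\ge 0$ be real constants, let $K\ge 1$, let $Z_i,Z_j\in\{0,1\}^K$ be row vectors, let $U\in\mathbb{R}^{K\times K}$, and put $\omega_{ij}=Z_iUZ_j^\top\in\mathbb{R}$. Let $y_{ij}\in\{-1,1\}$ and $\tilde y_{ij}=(y_{ij}+1)/2\in\{0,1\}$. Define $$\varphi_1(\tilde y_{ij}\mid Z_i,Z_j,U)=\frac{(e^{\omega_{ij}})^{c\tilde y_{ij}}}{(1+e^{\omega_{ij}})^{c}},\qquad \varphi_2(y_{ij}\mid Z_i,Z_j,U)=\exp\bigl(-2c\,(\ell-y_{ij}\omega_{ij})_+\bigr).$$ Then both $\varphi=\varphi_1$ and $\varphi=\varphi_2$ can be represented as $$\varphi(y_{ij}\mid Z_i,Z_j,U)\;\propto\;\int_0^\infty \exp\Bigl(\kappa_{ij}\omega_{ij}-\frac{\rho_{ij}\omega_{ij}^2}{2}\Bigr)\,\phi(\lambda_{ij})\,d\lambda_{ij},$$ where the constant of proportionality is positive and does not depend on $y_{ij},Z_i,Z_j,U$ (it may depend on $c$ and $\ell$), and where: (1) for $\varphi_1$: $\kappa_{ij}=c(\tilde y_{ij}-\tfrac12)$, $\rho_{ij}=\lambda_{ij}$, and $\phi$ is the density of the Polya-Gamma distribution $\mathcal{PG}(c,0)$, i.e. $\phi(\lambda_{ij})=\mathcal{PG}(\lambda_{ij};c,0)$; (2) for $\varphi_2$: with $\gamma_{ij}=\lambda_{ij}^{-1}$, $\kappa_{ij}=c\,y_{ij}(1+c\,\ell\,\gamma_{ij})$,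 $\rho_{ij}=c^2\gamma_{ij}$, and $\phi$ is the density of the generalized inverse Gaussian distribution $\mathcal{GIG}(\tfrac12,1,c^2\ell^2)$.
   Context: Notation: $(x)_+=\max(0,x)$. Polya-Gamma distribution: for $a>0$ and $b\in\mathbb{R}$, $\mathcal{PG}(a,b)$ is the law of the random variable $$X=\frac{1}{2\pi^2}\sum_{d=1}^\infty\frac{g_d}{(d-1/2)^2+b^2/(4\pi^2)},$$ where $g_1,g_2,\dots$ are independent random variables, each with the Gamma distribution with shape $a$ and rate $1$. $\mathcal{PG}(\lambda;a,b)$ denotes its density on $(0,\infty)$ at $\lambda$. Generalized inverse Gaussian distribution: $\mathcal{GIG}(p,a,b)$ is the probability distribution on $(0,\infty)$ with density proportional to $x^{p-1}\exp\bigl(-\tfrac12(ax+b/x)\bigr)$. In particular, $\mathcal{GIG}(\tfrac12,1,c^2\ell^2)$ has density proportional to $\lambda^{-1/2}\exp\bigl(-\tfrac12(\lambda+c^2\ell^2/\lambda)\bigr)$ (for $\ell=0$ this is a Gamma density). In (1) and (2), $\kappa_{ij}$ and $\rho_{ij}$ are allowed to depend on the integration variable $\lambda_{ij}$. *)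

theory Defs
  imports "HOL-Probability.Probability" "Jordan_Normal_Form.Matrix"
begin

text \<open>Gamma distribution with real shape \<open>a > 0\<close> and rate \<open>1\<close>.\<close>

definition gamma_density :: "real \<Rightarrow> real \<Rightarrow> real" where
  "gamma_density a x = (if x > 0 then x powr (a - 1) * exp (- x) / Gamma a else 0)"

definition gamma_distribution :: "real \<Rightarrow> real measure" where
  "gamma_distribution a = density lborel (\<lambda>x. ennreal (gamma_density a x))"

text \<open>
  The sequence of independent Gamma variables is the coordinate process on the infinite product
  space.  Indices start at \<open>0\<close> instead of \<open>1\<close>, so \<open>d - 1/2\<close> becomes \<open>d + 1/2\<close>.
  The series converges almost surely; \<open>suminf\<close> is arbitrary only on the exceptional null set.
\<close>

definition polya_gamma :: "real \<Rightarrow> real \<Rightarrow> real measure" where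
  "polya_gamma a b =
     distr (\<Pi>\<^sub>M d\<in>(UNIV :: nat set). gamma_distribution a) borel
       (\<lambda>g. 1 / (2 * pi\<^sup>2) * (\<Sum>d. g d / ((real d + 1/2)\<^sup>2 + b\<^sup>2 / (4 * pi\<^sup>2))))"

text \<open>
  The density is the Radon--Nikodym derivative with respect to Lebesgue measure, hence determined
  up to a null set.  \<open>RN_deriv\<close> is \<open>0\<close> if no density exists, so a claim that an integral
  against \<open>polya_gamma_density\<close> is positive includes the existence of the density.
\<close>

definition polya_gamma_density :: "real \<Rightarrow> real \<Rightarrow> real \<Rightarrow> real" where
  "polya_gamma_density a b x = enn2real (RN_deriv lborel (polya_gamma a b) x)"

definition gig_kernel :: "real \<Rightarrow> real \<Rightarrow> real \<Rightarrow> real \<Rightarrow> real" where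
  "gig_kernel p a b x = x powr (p - 1) * exp (- (a * x + b / x) / 2)"

definition gig_density :: "real \<Rightarrow> real \<Rightarrow> real \<Rightarrow> real \<Rightarrow> real" where
  "gig_density p a b x =
     (if x > 0 then gig_kernel p a b x / (LBINT t:{0<..}. gig_kernel p a b t) else 0)"

definition binary_vecs :: "nat \<Rightarrow> real vec set" where
  "binary_vecs K = {z \<in> carrier_vec K. \<forall>k<K. z $ k \<in> {0, 1}}"

text \<open>The single entry of the \<open>1 \<times> 1\<close> matrix obtained from row vectors \<open>Zi\<close>, \<open>Zj\<close>.\<close>

definition link_score :: "real vec \<Rightarrow> real vec \<Rightarrow> real mat \<Rightarrow> real" where
  "link_score Zi Zj U = (mat_of_row Zi * U * transpose_mat (mat_of_row Zj)) $$ (0, 0)"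

definition phi1 :: "real \<Rightarrow> real \<Rightarrow> real vec \<Rightarrow> real vec \<Rightarrow> real mat \<Rightarrow> real" where
  "phi1 c yt Zi Zj U =
     exp (link_score Zi Zj U) powr (c * yt) / (1 + exp (link_score Zi Zj U)) powr c"

definition phi2 :: "real \<Rightarrow> real \<Rightarrow> real \<Rightarrow> real vec \<Rightarrow> real vec \<Rightarrow> real mat \<Rightarrow> real" where
  "phi2 c l y Zi Zj U = exp (- 2 * c * max 0 (l - y * link_score Zi Zj U))"

text \<open>Both \<open>\<kappa>\<close> and \<open>\<rho>\<close> may depend on the integration variable.\<close>

definition mixture_integral ::
  "(real \<Rightarrow> real) \<Rightarrow> (real \<Rightarrow> real) \<Rightarrow> (real \<Rightarrow> real) \<Rightarrow> real \<Rightarrow> real" where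
  "mixture_integral \<kappa> \<rho> \<phi> \<omega> =
     (LBINT x:{0<..}. exp (\<kappa> x * \<omega> - \<rho> x * \<omega>\<^sup>2 / 2) * \<phi> x)"

end

theory Submission
  imports Defs "HOL-Real_Asymp.Real_Asymp"
begin

text \<open>
  Both claims are Laplace transforms. For \<open>\<phi>\<^sub>1\<close>, independence and the Gamma Laplace transform
  \<open>(1 + s) powr (- c)\<close> turn \<open>E exp (- \<omega>\<^sup>2 X / 2)\<close>, for \<open>X\<close> Polya-Gamma, into an infinite product which
  Euler's product evaluates to \<open>cosh (\<omega> / 2) powr (- c)\<close>; the density of \<open>X\<close> exists because the first
  summand of the series has one and is independent of the rest. For \<open>\<phi>\<^sub>2\<close>, completing the square
  with \<open>y\<^sup>2 = 1\<close> reduces the claim to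
  \<open>\<integral> x powr (- 1/2) * exp (- (x + a\<^sup>2 / x) / 2) = sqrt (2 * pi) * exp (- a)\<close> with
  \<open>a = c * \<bar>l - y * \<omega>\<bar>\<close>, together with \<open>2 * max 0 u = u + \<bar>u\<bar>\<close>.
\<close>

section \<open>Euler products for sinh and cosh\<close>

text \<open>Euler's sine product at the imaginary point \<open>\<i> * x\<close>: both sides become
  \<open>\<i>\<close> times a real number, and taking imaginary parts leaves the real
  identity.\<close>

lemma sinh_product_formula_real:
  "(\<lambda>n. pi * (x::real) * (\<Prod>k=1..n. 1 + x\<^sup>2 / real k ^ 2)) \<longlonglongrightarrow> sinh (pi * x)"
proof -
  have "(\<lambda>n. of_real pi * (\<i> * of_real x) * (\<Prod>k=1..n. 1 - (\<i> * of_real x)\<^sup>2 / of_nat k ^ 2)) \<longlonglongrightarrow>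
          sin (of_real pi * (\<i> * of_real x))"
    by (rule sin_product_formula_complex)
  also have "(\<lambda>n. of_real pi * (\<i> * of_real x) * (\<Prod>k=1..n. 1 - (\<i> * of_real x)\<^sup>2 / of_nat k ^ 2)) =
      (\<lambda>n. \<i> * of_real (pi * x * (\<Prod>k=1..n. 1 + x\<^sup>2 / real k ^ 2)))"
    by (simp add: power_mult_distrib mult_ac)
  also have "sin (of_real pi * (\<i> * of_real x)) = \<i> * complex_of_real (sinh (pi * x))"
    by (simp add: sinh_field_def sin_exp_eq exp_of_real [symmetric] algebra_simps)
      (simp add: field_simps)
  finally have "(\<lambda>n. Im (\<i> * of_real (pi * x * (\<Prod>k=1..n. 1 + x\<^sup>2 / real k ^ 2)))) \<longlonglongrightarrow>
      Im (\<i> * complex_of_real (sinh (pi * x)))"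
    by (rule tendsto_Im)
  then show ?thesis by (simp del: of_real_mult of_real_prod of_real_add)
qed

lemma prod_double_split:
  fixes f :: "nat \<Rightarrow> 'a :: comm_monoid_mult"
  shows "(\<Prod>k=1..2*n. f k) = (\<Prod>k=1..n. f (2 * k)) * (\<Prod>d<n. f (2 * d + 1))"
proof (induction n)
  case (Suc n)
  have "2 * Suc n = Suc (Suc (2 * n))" by simp
  then show ?case using Suc by (simp add: ac_simps)
qed simp

text \<open>By \<open>sinh (2 * z) = 2 * sinh z * cosh z\<close>, cosh is a quotient of two sinh
  products. The even-indexed factors of the product for \<open>2 * x\<close> are the factors for
  \<open>x\<close>, so dividing its partial product of length \<open>2 * n\<close> by twice that of
  length \<open>n\<close> leaves exactly the odd-indexed factors.\<close>

lemma cosh_product_formula_real: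
  "(\<lambda>n. \<Prod>d<n. 1 + (x::real)\<^sup>2 / (real d + 1/2)\<^sup>2) \<longlonglongrightarrow> cosh (pi * x)"
proof (cases "x = 0")
  case False
  let ?P = "\<lambda>n. pi * x * (\<Prod>k=1..n. 1 + x\<^sup>2 / real k ^ 2)"
  let ?Q = "\<lambda>n. pi * (2 * x) * (\<Prod>k=1..n. 1 + (2 * x)\<^sup>2 / real k ^ 2)"
  have "sinh (pi * x) \<noteq> 0" using False by simp
  moreover have "(\<lambda>n. ?Q (2 * n)) \<longlonglongrightarrow> sinh (pi * (2 * x))"
    using LIMSEQ_subseq_LIMSEQ[OF sinh_product_formula_real, of "\<lambda>n. 2 * n" "2 * x"]
    by (simp add: strict_mono_def o_def)
  ultimately have "(\<lambda>n. ?Q (2 * n) / (2 * ?P n)) \<longlonglongrightarrow> sinh (pi * (2 * x)) / (2 * sinh (pi * x))"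
    by (intro tendsto_intros sinh_product_formula_real) auto
  moreover have "?Q (2 * n) / (2 * ?P n) = (\<Prod>d<n. 1 + x\<^sup>2 / (real d + 1/2)\<^sup>2)" for n
  proof -
    have "(\<Prod>k=1..2*n. 1 + (2 * x)\<^sup>2 / real k ^ 2) =
        (\<Prod>k=1..n. 1 + x\<^sup>2 / real k ^ 2) * (\<Prod>d<n. 1 + (2 * x)\<^sup>2 / real (2 * d + 1) ^ 2)"
      by (subst prod_double_split) (simp add: power_mult_distrib)
    also have "(\<lambda>d. 1 + (2 * x)\<^sup>2 / real (2 * d + 1) ^ 2) = (\<lambda>d. 1 + x\<^sup>2 / (real d + 1/2)\<^sup>2)"
    proof
      fix d
      have "real (2 * d + 1) = 2 * (real d + 1/2)" by simp
      then show "1 + (2 * x)\<^sup>2 / real (2 * d + 1) ^ 2 = 1 + x\<^sup>2 / (real d + 1/2)\<^sup>2"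
        by (simp only: power_mult_distrib) simp
    qed
    finally have *: "(\<Prod>k=1..2*n. 1 + (2 * x)\<^sup>2 / real k ^ 2) =
        (\<Prod>k=1..n. 1 + x\<^sup>2 / real k ^ 2) * (\<Prod>d<n. 1 + x\<^sup>2 / (real d + 1/2)\<^sup>2)" .
    have "(\<Prod>k=1..n. 1 + x\<^sup>2 / real k ^ 2) \<noteq> 0"
      by (smt (verit, ccfv_SIG) prod_pos divide_nonneg_nonneg zero_le_power2)
    with False show ?thesis by (subst *) (simp add: field_simps)
  qed
  moreover have "sinh (pi * (2 * x)) / (2 * sinh (pi * x)) = cosh (pi * x)"
    using False sinh_double[of "pi * x"] by (simp add: mult.left_commute)
  ultimately show ?thesis by simp
qed simp

section \<open>The Gaussian primitive and the generalized inverse Gaussian integral\<close>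

lemma has_real_derivative_LBINT:
  fixes f :: "real \<Rightarrow> real"
  assumes "continuous_on UNIV f"
  shows "((\<lambda>u. LBINT y=ereal 0..ereal u. f y) has_real_derivative f x) (at x)"
proof -
  \<comment> \<open>The interval contains 0 and has \<open>x\<close> in its interior, so the
    derivative within it is the two-sided one.\<close>
  define A where "A = - \<bar>x\<bar> - 1"
  define B where "B = \<bar>x\<bar> + 1"
  have "((\<lambda>u. LBINT y=ereal 0..ereal u. f y) has_vector_derivative f x) (at x within {A..B})"
    by (rule interval_integral_FTC2)
      (auto simp: A_def B_def intro: continuous_on_subset[OF assms])
  moreover have "x \<in> {A<..<B}" by (auto simp: A_def B_def)
  ultimately show ?thesis
    by (metis at_within_Icc_at greaterThanLessThan_iff has_real_derivative_iff_has_vector_derivative)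
qed

text \<open>The error function up to scaling: \<open>sqrt (pi / 2) * erf (u / sqrt 2)\<close>.
  Starting the integral at 0 makes it odd, so its limit at minus infinity follows from the one at
  infinity.\<close>

definition gauss_primitive :: "real \<Rightarrow> real" where
  "gauss_primitive u = (LBINT y=ereal 0..ereal u. exp (- y\<^sup>2 / 2))"

lemma gauss_primitive_0 [simp]: "gauss_primitive 0 = 0"
  by (simp add: gauss_primitive_def)

lemma gauss_primitive_minus: "gauss_primitive (- u) = - gauss_primitive u"
  unfolding gauss_primitive_def
  by (subst interval_integral_reflect, subst interval_integral_endpoints_reverse) simp

lemma has_real_derivative_gauss_primitive [derivative_intros]:
  assumes "(g has_real_derivative g') (at x within A)"
  shows "((\<lambda>x. gauss_primitive (g x)) has_real_derivative exp (- (g x)\<^sup>2 / 2) * g') (at x within A)"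
proof -
  have "(gauss_primitive has_real_derivative exp (- (g x)\<^sup>2 / 2)) (at (g x))"
    unfolding gauss_primitive_def [abs_def]
    by (rule has_real_derivative_LBINT) (intro continuous_intros, simp)
  from DERIV_chain2[OF this assms] show ?thesis .
qed

lemma gauss_primitive_at_top: "(gauss_primitive \<longlongrightarrow> sqrt (2 * pi) / 2) at_top"
proof -
  let ?f = "\<lambda>y::real. exp (- y\<^sup>2 / 2)"
  \<comment> \<open>Rescaling by \<open>1 / sqrt 2\<close> turns the half-line integral of
    \<open>exp (- y\<^sup>2)\<close> into that of \<open>exp (- y\<^sup>2 / 2)\<close>.\<close>
  have "has_bochner_integral lborel (\<lambda>x. indicator {0..} (0 + (1 / sqrt 2) * x) *\<^sub>R exp (- (0 + (1 / sqrt 2) * x)\<^sup>2))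
      ((sqrt pi / 2) /\<^sub>R \<bar>1 / sqrt 2\<bar>)"
    by (rule lborel_has_bochner_integral_real_affine_iff[THEN iffD1, OF _ gaussian_moment_0]) auto
  also have "(\<lambda>x::real. indicator {0..} (0 + (1 / sqrt 2) * x) *\<^sub>R exp (- (0 + (1 / sqrt 2) * x)\<^sup>2)) =
      (\<lambda>x. indicator {0..} x *\<^sub>R ?f x)"
    by (auto simp: fun_eq_iff indicator_def power_mult_distrib power_divide zero_le_divide_iff)
  also have "(sqrt pi / 2) /\<^sub>R \<bar>1 / sqrt 2\<bar> = sqrt (2 * pi) / 2"
    by (simp add: real_sqrt_mult divide_simps)
  finally have *: "set_integrable lborel {0..} ?f" "(LBINT y:{0..}. ?f y) = sqrt (2 * pi) / 2"
    by (auto simp: has_bochner_integral_iff set_integrable_def set_lebesgue_integral_def)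
  have "((\<lambda>u. LBINT y:{0..u}. ?f y) \<longlongrightarrow> sqrt (2 * pi) / 2) at_top"
    using tendsto_set_lebesgue_integral_at_top[OF _ *(1)] unfolding *(2) by simp
  moreover have "\<forall>\<^sub>F u in at_top. (LBINT y:{0..u}. ?f y) = gauss_primitive u"
    using eventually_ge_at_top[of 0]
    by eventually_elim (simp add: gauss_primitive_def interval_integral_Icc)
  ultimately show ?thesis
    by (rule Lim_transform_eventually)
qed

lemma gauss_primitive_at_bot: "(gauss_primitive \<longlongrightarrow> - (sqrt (2 * pi) / 2)) at_bot"
  unfolding filterlim_at_bot_mirror gauss_primitive_minus
  by (intro tendsto_minus gauss_primitive_at_top)

text \<open>
  The integrand has an elementary antiderivative in terms of the Gaussian primitive \<open>E\<close>, because
  \<open>(sqrt x \<mp> a / sqrt x)\<^sup>2 = x + a\<^sup>2 / x \<mp> 2 * a\<close>.  For \<open>a = 0\<close> only the limit at \<open>0\<close> differs.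
\<close>

lemma gig_half_integral:
  assumes a: "a \<ge> 0"
  shows "set_integrable lborel {0<..} (gig_kernel (1/2) 1 (a\<^sup>2))" (is ?A)
    and "(LBINT x:{0<..}. gig_kernel (1/2) 1 (a\<^sup>2) x) = sqrt (2 * pi) * exp (- a)" (is ?B)
proof -
  let ?f = "gig_kernel (1/2) 1 (a\<^sup>2)"
  let ?E = gauss_primitive
  let ?F = "\<lambda>x. exp (- a) * ?E (sqrt x - a / sqrt x) + exp a * ?E (sqrt x + a / sqrt x)"
  define L where "L = sqrt (2 * pi) / 2"
  have f: "?f x = exp (- (x + a\<^sup>2 / x) / 2) / sqrt x" if "x > 0" for x
    using that by (simp add: gig_kernel_def powr_minus powr_half_sqrt field_simps)
  have deriv: "(?F has_real_derivative ?f x) (at x)" if x: "x > 0" for x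
  proof -
    let ?s = "sqrt x"
    have s: "?s > 0" "?s * ?s = x" using x by auto
    have d1: "((\<lambda>x. sqrt x - a / sqrt x) has_real_derivative (1 + a / x) / (2 * ?s)) (at x)"
      using x s by (auto intro!: derivative_eq_intros simp: field_simps)
    have d2: "((\<lambda>x. sqrt x + a / sqrt x) has_real_derivative (1 - a / x) / (2 * ?s)) (at x)"
      using x s by (auto intro!: derivative_eq_intros simp: field_simps)
    have e1: "exp (- a) * exp (- (?s - a / ?s)\<^sup>2 / 2) = exp (- (x + a\<^sup>2 / x) / 2)"
      using x by (simp flip: exp_add add: power2_diff power_divide field_simps)
        (simp add: power2_eq_square)
    have e2: "exp a * exp (- (?s + a / ?s)\<^sup>2 / 2) = exp (- (x + a\<^sup>2 / x) / 2)"
      using x by (simp flip: exp_add add: power2_sum power_divide field_simps)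
        (simp add: power2_eq_square)
    have "(?F has_real_derivative
        (exp (- a) * exp (- (?s - a / ?s)\<^sup>2 / 2)) * ((1 + a / x) / (2 * ?s)) +
        (exp a * exp (- (?s + a / ?s)\<^sup>2 / 2)) * ((1 - a / x) / (2 * ?s))) (at x)"
      unfolding mult.assoc
      by (intro DERIV_add DERIV_cmult has_real_derivative_gauss_primitive d1 d2)
    \<comment> \<open>By \<open>e1\<close> and \<open>e2\<close> both summands carry the same
      exponential; the terms in \<open>a / x\<close> cancel and leave
      \<open>1 / sqrt x\<close>.\<close>
    also have "(exp (- a) * exp (- (?s - a / ?s)\<^sup>2 / 2)) * ((1 + a / x) / (2 * ?s)) +
        (exp a * exp (- (?s + a / ?s)\<^sup>2 / 2)) * ((1 - a / x) / (2 * ?s)) = ?f x"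
      unfolding e1 e2 f[OF x] using s x by (simp add: field_simps)
    finally show ?thesis .
  qed
  have top: "(?F \<longlongrightarrow> exp (- a) * L + exp a * L) at_top"
  proof -
    have "filterlim (\<lambda>x. sqrt x - a / sqrt x) at_top at_top" "filterlim (\<lambda>x. sqrt x + a / sqrt x) at_top at_top"
      by real_asymp+
    then show ?thesis
      unfolding L_def by (intro tendsto_intros filterlim_compose[OF gauss_primitive_at_top])
  qed
  \<comment> \<open>The limit at 0 is written as the limit at infinity minus the claimed integral, a
    form common to both cases: for \<open>a = 0\<close> both arguments of \<open>?E\<close> tend to
    0, for \<open>a > 0\<close> they tend to minus and plus infinity.\<close>
  have bot: "(?F \<longlongrightarrow> exp (- a) * L + exp a * L - sqrt (2 * pi) * exp (- a)) (at_right 0)"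
  proof (cases "a = 0")
    case True
    have "isCont gauss_primitive 0"
      using has_real_derivative_gauss_primitive[OF DERIV_ident] by (rule DERIV_isCont)
    moreover have "(sqrt \<longlongrightarrow> 0) (at_right 0)" by real_asymp
    ultimately have "((\<lambda>x. ?E (sqrt x)) \<longlongrightarrow> ?E 0) (at_right 0)"
      by (rule isCont_tendsto_compose)
    from tendsto_add[OF this this] show ?thesis using True by (simp add: L_def)
  next
    case False
    then have "a > 0" using a by simp
    then have "filterlim (\<lambda>x. sqrt x - a / sqrt x) at_bot (at_right 0)"
       "filterlim (\<lambda>x. sqrt x + a / sqrt x) at_top (at_right 0)"
      by real_asymp+
    then have "(?F \<longlongrightarrow> exp (- a) * (- L) + exp a * L) (at_right 0)"
      unfolding L_def
      by (intro tendsto_intros filterlim_compose[OF gauss_primitive_at_top] filterlim_compose[OF gauss_primitive_at_bot])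
    also have "exp (- a) * (- L) + exp a * L = exp (- a) * L + exp a * L - sqrt (2 * pi) * exp (- a)"
      by (simp add: L_def)
    finally show ?thesis .
  qed
  have nonneg: "?f x \<ge> 0" for x
    by (simp add: gig_kernel_def)
  have cont: "isCont ?f x" if "x > 0" for x
    unfolding gig_kernel_def using that by (intro continuous_intros) auto
  have *: "set_integrable lborel (einterval 0 \<infinity>) ?f"
    "(LBINT x=0..\<infinity>. ?f x) = exp (- a) * L + exp a * L - (exp (- a) * L + exp a * L - sqrt (2 * pi) * exp (- a))"
    by (rule interval_integral_FTC_nonneg[where F = ?F];
        use deriv cont nonneg top bot in \<open>simp add: zero_ereal_def ereal_tendsto_simps\<close>)+
  show ?A using *(1) by (simp add: zero_ereal_def)
  show ?B using *(2) interval_integral_to_infinity_eq[where M = lborel and a = 0 and f = ?f] by (simp add: zero_ereal_def)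
qed

section \<open>The Gamma distribution\<close>

lemma borel_measurable_gamma_density [measurable]: "gamma_density a \<in> borel_measurable borel"
  unfolding gamma_density_def by measurable

lemma sets_gamma_distribution [simp, measurable_cong]: "sets (gamma_distribution a) = sets borel"
  by (simp add: gamma_distribution_def)

lemma space_gamma_distribution [simp]: "space (gamma_distribution a) = UNIV"
  by (simp add: gamma_distribution_def)

lemma gamma_density_nonneg: "a > 0 \<Longrightarrow> gamma_density a x \<ge> 0"
  by (simp add: gamma_density_def Gamma_real_pos less_imp_le)

lemma nn_integral_gamma_distribution:
  assumes "a > 0" "f \<in> borel_measurable borel"
  shows "(\<integral>\<^sup>+x. f x \<partial>gamma_distribution a) = (\<integral>\<^sup>+x. ennreal (gamma_density a x) * f x \<partial>lborel)"
  unfolding gamma_distribution_def using assms by (subst nn_integral_density) auto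

text \<open>The substitution \<open>t = (1 + r) * x\<close> produces the Gamma integral; the power
  contributes \<open>(1 + r) powr (1 - a)\<close> and the Jacobian \<open>1 / (1 + r)\<close>. At
  \<open>r = 0\<close> this also yields total mass 1.\<close>

lemma laplace_gamma_distribution:
  assumes a: "a > 0" and r: "r \<ge> 0"
  shows "(\<integral>\<^sup>+x. ennreal (exp (- r * x)) \<partial>gamma_distribution a) = ennreal ((1 + r) powr (- a))"
proof -
  let ?G = "\<lambda>t. indicator {0..} t * t powr (a - 1) / exp t :: real"
  have G: "0 < Gamma a" using a by (rule Gamma_real_pos)
  have eq: "gamma_density a x * exp (- r * x) = (1 + r) powr (1 - a) / Gamma a * ?G (0 + (1 + r) * x)" for x
  proof (cases "x > 0")
    case True
    have "(1 + r) powr (1 - a) * (1 + r) powr (a - 1) = 1"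
      using r by (simp flip: powr_add)
    moreover have "exp (- x) * exp (- r * x) = 1 / exp ((1 + r) * x)"
      by (simp flip: exp_add exp_minus add: exp_minus_inverse field_simps)
    ultimately have "x powr (a - 1) * (exp (- x) * exp (- r * x)) =
        ((1 + r) powr (1 - a) * (1 + r) powr (a - 1)) * x powr (a - 1) / exp ((1 + r) * x)"
      by simp
    then show ?thesis
      using True r G by (simp add: gamma_density_def powr_mult mult_ac)
  next
    \<comment> \<open>At \<open>x = 0\<close> the density is 0 by definition, and
      \<open>0 powr (a - 1) = 0\<close> makes the other side agree.\<close>
    case False
    then show ?thesis
      using r by (cases "x = 0") (auto simp: gamma_density_def zero_le_mult_iff)
  qed
  have "(\<integral>\<^sup>+x. ennreal (exp (- r * x)) \<partial>gamma_distribution a) =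
      (\<integral>\<^sup>+x. ennreal (gamma_density a x * exp (- r * x)) \<partial>lborel)"
    using a by (subst nn_integral_gamma_distribution) (auto simp: ennreal_mult gamma_density_nonneg)
  also have "\<dots> = (\<integral>\<^sup>+x. ennreal ((1 + r) powr (1 - a) / Gamma a) * ennreal (?G (0 + (1 + r) * x)) \<partial>lborel)"
    unfolding eq using r G by (intro nn_integral_cong ennreal_mult) auto
  also have "\<dots> = ennreal ((1 + r) powr (1 - a) / Gamma a) * (\<integral>\<^sup>+x. ennreal (?G (0 + (1 + r) * x)) \<partial>lborel)"
    by (rule nn_integral_cmult) measurable
  \<comment> \<open>One factor \<open>1 + r\<close> is split off to serve as the Jacobian of the
    substitution.\<close>
  also have "(1 + r) powr (1 - a) / Gamma a = (1 + r) powr (- a) / Gamma a * (1 + r)"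
    using r by (simp add: powr_diff powr_minus field_simps)
  also have "ennreal ((1 + r) powr (- a) / Gamma a * (1 + r)) * (\<integral>\<^sup>+x. ennreal (?G (0 + (1 + r) * x)) \<partial>lborel) =
      ennreal ((1 + r) powr (- a) / Gamma a) * (ennreal \<bar>1 + r\<bar> * (\<integral>\<^sup>+x. ennreal (?G (0 + (1 + r) * x)) \<partial>lborel))"
    using r G by (subst ennreal_mult) (auto simp: mult.assoc)
  also have "ennreal \<bar>1 + r\<bar> * (\<integral>\<^sup>+x. ennreal (?G (0 + (1 + r) * x)) \<partial>lborel) = (\<integral>\<^sup>+x. ennreal (?G x) \<partial>lborel)"
    using r by (subst nn_integral_real_affine[of "\<lambda>x. ennreal (?G x)" "1 + r" 0]) auto
  also have "\<dots> = ennreal (Gamma a)"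
    using a by (rule Gamma_conv_nn_integral_real[symmetric])
  also have "ennreal ((1 + r) powr (- a) / Gamma a) * ennreal (Gamma a) = ennreal ((1 + r) powr (- a))"
    using G by (simp flip: ennreal_mult)
  finally show ?thesis .
qed

lemma prob_space_gamma_distribution:
  assumes "a > 0"
  shows "prob_space (gamma_distribution a)"
  using laplace_gamma_distribution[OF assms, of 0] by (intro prob_spaceI) simp

text \<open>The extra factor \<open>x\<close> raises the shape by one, so the integral is
  \<open>Gamma (a + 1) / Gamma a\<close>. Finite means give almost sure convergence of the weighted
  series below.\<close>

lemma mean_gamma_distribution:
  assumes a: "a > 0"
  shows "(\<integral>\<^sup>+x. ennreal x \<partial>gamma_distribution a) = ennreal a"
proof -
  let ?G = "\<lambda>t. indicator {0..} t * t powr (a + 1 - 1) / exp t :: real"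
  have G: "0 < Gamma a" using a by (rule Gamma_real_pos)
  have eq: "ennreal (gamma_density a x) * ennreal x = ennreal (1 / Gamma a) * ennreal (?G x)" for x
    using G by (cases "x > 0")
      (auto simp: gamma_density_def powr_diff exp_minus field_simps indicator_def simp flip: ennreal_mult)
  have "(\<integral>\<^sup>+x. ennreal x \<partial>gamma_distribution a) = ennreal (1 / Gamma a) * (\<integral>\<^sup>+x. ennreal (?G x) \<partial>lborel)"
    using a by (subst nn_integral_gamma_distribution) (auto simp: eq intro: nn_integral_cmult)
  also have "(\<integral>\<^sup>+x. ennreal (?G x) \<partial>lborel) = ennreal (Gamma (a + 1))"
    using a by (intro Gamma_conv_nn_integral_real[symmetric]) simp
  also have "Gamma (a + 1) = a * Gamma a"
    using a by (intro Gamma_plus1) auto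
  also have "ennreal (1 / Gamma a) * ennreal (a * Gamma a) = ennreal a"
    using a less_imp_neq[OF G, symmetric] by (simp flip: ennreal_mult)
  finally show ?thesis .
qed

lemma AE_gamma_distribution_nonneg: "AE x in gamma_distribution a. x \<ge> 0"
  unfolding gamma_distribution_def by (subst AE_density) (auto simp: gamma_density_def)

lemma absolutely_continuous_gamma_distribution:
  "absolutely_continuous lborel (gamma_distribution a)"
  unfolding gamma_distribution_def by (intro absolutely_continuousI_density) measurable

section \<open>Weighted series of independent Gamma variables\<close>

lemma sequence_space_gamma_distribution:
  assumes "a > 0"
  shows "sequence_space (gamma_distribution a)"
  unfolding sequence_space_def
  by (intro product_prob_spaceI prob_space_gamma_distribution assms)

text \<open>Independence of the coordinates in integrated form. By \<open>PiM_iter\<close> a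
  sequence is a first coordinate paired with an independent sequence of the same law; peeling it off
  shifts the family \<open>f\<close>, which is therefore arbitrary in the induction.\<close>

lemma (in sequence_space) nn_integral_PiM_prod_lessThan:
  assumes [measurable]: "\<And>i. f i \<in> borel_measurable M"
  shows "(\<integral>\<^sup>+\<omega>. (\<Prod>i<n. f i (\<omega> i)) \<partial>S) = (\<Prod>i<n. \<integral>\<^sup>+x. f i x \<partial>M)"
  using assms
proof (induction n arbitrary: f)
  case 0
  then show ?case by (simp add: P.emeasure_space_1)
next
  case (Suc n)
  note [measurable] = Suc.prems
  have "(\<integral>\<^sup>+\<omega>. (\<Prod>i<Suc n. f i (\<omega> i)) \<partial>S) =
      (\<integral>\<^sup>+(s, \<omega>). f 0 s * (\<Prod>i<n. f (Suc i) (\<omega> i)) \<partial>(M \<Otimes>\<^sub>M S))"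
    by (subst PiM_iter[symmetric], subst nn_integral_distr)
      (auto simp: prod.lessThan_Suc_shift split_beta' simp del: prod.lessThan_Suc intro!: nn_integral_cong)
  also have "\<dots> = (\<integral>\<^sup>+s. \<integral>\<^sup>+\<omega>. f 0 s * (\<Prod>i<n. f (Suc i) (\<omega> i)) \<partial>S \<partial>M)"
    by (subst P.nn_integral_fst[symmetric]) (auto simp: split_beta')
  also have "\<dots> = (\<integral>\<^sup>+s. f 0 s * (\<integral>\<^sup>+\<omega>. (\<Prod>i<n. f (Suc i) (\<omega> i)) \<partial>S) \<partial>M)"
    by (intro nn_integral_cong nn_integral_cmult) measurable
  also have "\<dots> = (\<integral>\<^sup>+s. f 0 s \<partial>M) * (\<Prod>i<n. \<integral>\<^sup>+x. f (Suc i) x \<partial>M)"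
    by (subst Suc.IH) (auto intro: nn_integral_multc)
  finally show ?case by (simp add: prod.lessThan_Suc_shift del: prod.lessThan_Suc)
qed

text \<open>By monotone convergence the sum of the integrals is the integral of the sum, and a
  function with finite integral is finite almost everywhere.\<close>

lemma summable_sum_nonneg_AE:
  fixes f :: "nat \<Rightarrow> 'a \<Rightarrow> real"
  assumes [measurable]: "\<And>i. f i \<in> borel_measurable M"
    and nonneg: "AE x in M. \<forall>i. f i x \<ge> 0"
    and fin: "(\<Sum>i. \<integral>\<^sup>+x. ennreal (f i x) \<partial>M) < \<infinity>"
  shows "AE x in M. summable (\<lambda>i. f i x)"
proof -
  have "(\<integral>\<^sup>+x. (\<Sum>i. ennreal (f i x)) \<partial>M) \<noteq> \<infinity>"
    using fin by (subst nn_integral_suminf) auto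
  then have "AE x in M. (\<Sum>i. ennreal (f i x)) \<noteq> \<infinity>"
    by (intro nn_integral_PInf_AE) auto
  with nonneg show ?thesis
    by eventually_elim (auto intro: summable_suminf_not_top)
qed

text \<open>Keeping the weights general makes the tail of a series, with weights
  \<open>w (Suc d)\<close>, another instance; this is used when the first coordinate is separated
  from the rest.\<close>

locale gamma_series =
  fixes a :: real and w :: "nat \<Rightarrow> real"
  assumes shape_pos: "a > 0"
    and weight_pos: "\<And>d. w d > 0"
    and summable_weight: "summable w"
begin

sublocale sequence_space "gamma_distribution a"
  using shape_pos by (rule sequence_space_gamma_distribution)

abbreviation series :: "(nat \<Rightarrow> real) \<Rightarrow> real" where
  "series g \<equiv> (\<Sum>d. w d * g d)"

lemma measurable_coordinate: "(\<lambda>g. g d) \<in> borel_measurable S"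
  using measurable_component_singleton[of d UNIV "\<lambda>_. gamma_distribution a"]
  by (simp add: measurable_cong_sets[OF refl sets_gamma_distribution])

lemma measurable_series [measurable]: "series \<in> borel_measurable S"
  by measurable

lemma AE_nonneg: "AE g in S. \<forall>d. g d \<ge> 0"
  unfolding AE_all_countable
  by (auto intro!: AE_PiM_component AE_gamma_distribution_nonneg prob_space_gamma_distribution shape_pos)

lemma nn_integral_coordinate:
  assumes [measurable]: "f \<in> borel_measurable borel"
  shows "(\<integral>\<^sup>+g. f (g d) \<partial>S) = (\<integral>\<^sup>+x. f x \<partial>gamma_distribution a)"
proof -
  have "(\<integral>\<^sup>+x. f x \<partial>gamma_distribution a) =
      (\<integral>\<^sup>+x. f x \<partial>distr S (gamma_distribution a) (\<lambda>g. g d))"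
    by (subst PiM_component) auto
  also have "\<dots> = (\<integral>\<^sup>+g. f (g d) \<partial>S)"
    by (rule nn_integral_distr[OF measurable_component_singleton]) (use assms in \<open>simp_all cong: measurable_cong_sets\<close>)
  finally show ?thesis by simp
qed

text \<open>The term \<open>w d * g d\<close> has mean \<open>w d * a\<close>, and these means are
  summable.\<close>

lemma AE_summable: "AE g in S. summable (\<lambda>d. w d * g d)"
proof (rule summable_sum_nonneg_AE)
  show "AE g in S. \<forall>d. w d * g d \<ge> 0"
    using AE_nonneg by eventually_elim (auto intro: mult_nonneg_nonneg less_imp_le[OF weight_pos])
  have "(\<integral>\<^sup>+g. ennreal (w d * g d) \<partial>S) = ennreal (w d * a)" for d
  proof -
    have "(\<integral>\<^sup>+g. ennreal (w d * g d) \<partial>S) = (\<integral>\<^sup>+g. ennreal (w d) * ennreal (g d) \<partial>S)"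
      using weight_pos[of d] by (simp add: ennreal_mult')
    also have "\<dots> = ennreal (w d) * (\<integral>\<^sup>+x. ennreal x \<partial>gamma_distribution a)"
      by (subst nn_integral_cmult) (auto simp: nn_integral_coordinate[of ennreal])
    finally show ?thesis
      using weight_pos[of d] shape_pos by (simp add: mean_gamma_distribution ennreal_mult')
  qed
  moreover have "(\<Sum>d. ennreal (w d * a)) = ennreal (\<Sum>d. w d * a)"
    using shape_pos weight_pos summable_weight
    by (intro suminf_ennreal2 summable_mult2) (auto intro: mult_nonneg_nonneg less_imp_le)
  ultimately show "(\<Sum>d. \<integral>\<^sup>+g. ennreal (w d * g d) \<partial>S) < \<infinity>"
    by simp
qed (intro borel_measurable_times measurable_coordinate borel_measurable_const)

text \<open>The exponential of the sum is a product over independent coordinates, and each factor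
  integrates to the Gamma Laplace transform at \<open>s * w d\<close>.\<close>

lemma laplace_partial_sum:
  assumes "s \<ge> 0"
  shows "(\<integral>g. exp (- s * (\<Sum>d<n. w d * g d)) \<partial>S) = (\<Prod>d<n. 1 + s * w d) powr (- a)"
proof -
  have pos: "1 + s * w d > 0" for d
    using assms weight_pos[of d] by (smt (verit) mult_nonneg_nonneg)
  have "(\<integral>\<^sup>+g. ennreal (exp (- s * (\<Sum>d<n. w d * g d))) \<partial>S) =
      (\<integral>\<^sup>+g. (\<Prod>d<n. ennreal (exp (- (s * w d) * g d))) \<partial>S)"
    by (simp add: prod_ennreal sum_distrib_left sum_negf exp_sum[symmetric] mult.assoc)
  also have "\<dots> = (\<Prod>d<n. \<integral>\<^sup>+x. ennreal (exp (- (s * w d) * x)) \<partial>gamma_distribution a)"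
    by (rule nn_integral_PiM_prod_lessThan) simp
  also have "\<dots> = (\<Prod>d<n. ennreal ((1 + s * w d) powr (- a)))"
    using assms weight_pos shape_pos
    by (intro prod.cong refl laplace_gamma_distribution) (auto simp: less_imp_le)
  also have "\<dots> = ennreal ((\<Prod>d<n. 1 + s * w d) powr (- a))"
    using pos by (simp add: prod_ennreal prod_powr_distrib less_imp_le)
  finally show ?thesis
    by (intro integral_eq_nn_integral[THEN trans]) auto
qed

text \<open>The partial sums converge almost surely and are nonnegative, so their exponentials are
  dominated by 1 and the limit passes under the integral.\<close>

lemma laplace_series:
  assumes s: "s \<ge> 0" and lim: "(\<lambda>n. \<Prod>d<n. 1 + s * w d) \<longlonglongrightarrow> L"
  shows "(\<integral>g. exp (- s * series g) \<partial>S) = L powr (- a)"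
proof (rule LIMSEQ_unique)
  show "(\<lambda>n. \<integral>g. exp (- s * (\<Sum>d<n. w d * g d)) \<partial>S) \<longlonglongrightarrow> (\<integral>g. exp (- s * series g) \<partial>S)"
  proof (rule integral_dominated_convergence[where w = "\<lambda>_. 1"])
    show "AE g in S. (\<lambda>n. exp (- s * (\<Sum>d<n. w d * g d))) \<longlonglongrightarrow> exp (- s * series g)"
      using AE_summable by eventually_elim (intro tendsto_intros summable_LIMSEQ)
    show "AE g in S. norm (exp (- s * (\<Sum>d<n. w d * g d))) \<le> 1" for n
      using AE_nonneg
    proof eventually_elim
      case (elim g)
      then have "(\<Sum>d<n. w d * g d) \<ge> 0"
        by (intro sum_nonneg mult_nonneg_nonneg less_imp_le[OF weight_pos]) auto
      with s show ?case by simp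
    qed
  qed auto
  \<comment> \<open>A nonzero limit is what continuity of \<open>powr\<close> in the base
    requires.\<close>
  have "L \<ge> 1"
    using s weight_pos
    by (intro LIMSEQ_le_const[OF lim] exI[of _ 0] allI impI prod_ge_1) (simp add: less_imp_le)
  then show "(\<lambda>n. \<integral>g. exp (- s * (\<Sum>d<n. w d * g d)) \<partial>S) \<longlonglongrightarrow> L powr (- a)"
    unfolding laplace_partial_sum[OF s] by (intro tendsto_powr[OF lim tendsto_const]) auto
qed

text \<open>Conditionally on the remaining coordinates, the series is an affine function of the first
  one, which has a density.\<close>

lemma absolutely_continuous_series: "absolutely_continuous lborel (distr S borel series)"
  unfolding absolutely_continuous_def
proof
  fix N assume "N \<in> null_sets (lborel :: real measure)"
  then have [measurable]: "N \<in> sets borel" and N: "emeasure lborel N = 0"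
    by auto
  \<comment> \<open>An affine map with nonzero slope pulls Lebesgue null sets back to Lebesgue null
    sets, which the Gamma law does not charge.\<close>
  have preimage: "AE x in gamma_distribution a. w 0 * x + t \<notin> N" for t
  proof -
    have "AE x in lborel. x \<notin> N"
      using N by (intro AE_not_in) auto
    then have "AE x in distr lborel borel (\<lambda>x. t + w 0 * x). x \<notin> N"
      using weight_pos[of 0]
      by (subst (asm) lborel_real_affine[of "w 0" t]) (auto simp: AE_density)
    then have "AE x in lborel. w 0 * x + t \<notin> N"
      by (subst (asm) AE_distr_iff) (auto simp: add.commute)
    then show ?thesis
      by (intro absolutely_continuous_AE[OF _ absolutely_continuous_gamma_distribution]) auto
  qed
  \<comment> \<open>Splitting off the head term of \<open>suminf\<close> relies on convergence,
    hence the condition on the tail.\<close>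
  have split: "series (case_nat x g) = w 0 * x + (\<Sum>d. w (Suc d) * g d)"
    if "summable (\<lambda>d. w (Suc d) * g d)" for x g
  proof -
    have "summable (\<lambda>d. w d * case_nat x g d)"
      using that by (subst summable_Suc_iff[symmetric]) simp
    from suminf_split_head[OF this] show ?thesis by simp
  qed
  interpret tail: gamma_series a "\<lambda>d. w (Suc d)"
    using shape_pos weight_pos summable_weight by unfold_locales (auto simp: summable_Suc_iff)
  interpret pair: pair_sigma_finite "gamma_distribution a" S
    by unfold_locales
  have "AE g in S. AE x in gamma_distribution a. series (case_nat x g) \<notin> N"
    using tail.AE_summable by eventually_elim (use split preimage in simp)
  \<comment> \<open>Joint measurability lets Fubini exchange the two almost-everywhere quantifiers
    and pass to the product measure, which \<open>PiM_iter\<close> then identifies with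
    \<open>S\<close>.\<close>
  moreover have "{p \<in> space (gamma_distribution a \<Otimes>\<^sub>M S). series (case_nat (fst p) (snd p)) \<notin> N} \<in>
      sets (gamma_distribution a \<Otimes>\<^sub>M S)"
    by measurable
  ultimately have "AE p in gamma_distribution a \<Otimes>\<^sub>M S. series (case_nat (fst p) (snd p)) \<notin> N"
    using pair.AE_commute[of "\<lambda>x g. series (case_nat x g) \<notin> N"]
      pair.AE_pair_iff[of "\<lambda>x g. series (case_nat x g) \<notin> N"] by simp
  then have "AE g in distr (gamma_distribution a \<Otimes>\<^sub>M S) S (\<lambda>(x, g). case_nat x g). series g \<notin> N"
    by (subst AE_distr_iff) (auto simp: split_beta')
  then have "AE g in S. series g \<notin> N"
    unfolding PiM_iter .
  then show "N \<in> null_sets (distr S borel series)"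
    by (subst AE_iff_null_sets) (auto simp: AE_distr_iff)
qed

end

section \<open>The Polya-Gamma distribution\<close>

text \<open>The prefactor \<open>1 / (2 * pi\<^sup>2)\<close> is absorbed into the weights so that
  the series has the form treated in \<open>gamma_series\<close>.\<close>

definition polya_gamma_weight :: "real \<Rightarrow> nat \<Rightarrow> real" where
  "polya_gamma_weight b d = 1 / (2 * pi\<^sup>2 * ((real d + 1/2)\<^sup>2 + b\<^sup>2 / (4 * pi\<^sup>2)))"

text \<open>Summability follows by comparison with the inverse squares, since
  \<open>(d + 1) / 2 \<le> d + 1/2\<close>.\<close>

lemma gamma_series_polya_gamma_weight:
  assumes "a > 0"
  shows "gamma_series a (polya_gamma_weight b)"
proof
  show pos: "polya_gamma_weight b d > 0" for d
    by (simp add: polya_gamma_weight_def add_pos_nonneg)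
  have "norm (polya_gamma_weight b d) \<le> 2 / pi\<^sup>2 * (1 / (real d + 1)\<^sup>2)" for d
  proof -
    have "((real d + 1) / 2)\<^sup>2 \<le> (real d + 1/2)\<^sup>2"
      by (intro power_mono) auto
    also have "\<dots> \<le> (real d + 1/2)\<^sup>2 + b\<^sup>2 / (4 * pi\<^sup>2)"
      by simp
    finally have "polya_gamma_weight b d \<le> 1 / (2 * pi\<^sup>2 * ((real d + 1) / 2)\<^sup>2)"
      unfolding polya_gamma_weight_def by (intro divide_left_mono mult_left_mono) (auto intro!: mult_pos_pos add_pos_nonneg)
    also have "\<dots> = 2 / pi\<^sup>2 * (1 / (real d + 1)\<^sup>2)"
      by (simp add: power_divide)
    finally show ?thesis using pos[of d] by simp
  qed
  moreover have "summable (\<lambda>d. 2 / pi\<^sup>2 * (1 / (real d + 1)\<^sup>2))"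
    using inverse_squares_sums by (intro summable_mult) (auto simp: sums_iff add.commute)
  ultimately show "summable (polya_gamma_weight b)"
    using summable_comparison_test'[where N = 0] by blast
qed fact

lemma sets_polya_gamma [simp, measurable_cong]: "sets (polya_gamma a b) = sets borel"
  by (simp add: polya_gamma_def)

context
  fixes a b :: real
  assumes a: "a > 0"
begin

interpretation gamma_series a "polya_gamma_weight b"
  using a by (rule gamma_series_polya_gamma_weight)

text \<open>Moving the prefactor inside the sum is justified where the series converges, hence
  almost surely, which suffices for equality of the laws.\<close>

lemma polya_gamma_eq_distr_series: "polya_gamma a b = distr S borel series"
  unfolding polya_gamma_def
proof (rule distr_cong_AE)
  show "AE g in S. 1 / (2 * pi\<^sup>2) * (\<Sum>d. g d / ((real d + 1/2)\<^sup>2 + b\<^sup>2 / (4 * pi\<^sup>2))) = series g"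
    using AE_summable
  proof eventually_elim
    case (elim g)
    have "summable (\<lambda>d. 2 * pi\<^sup>2 * (polya_gamma_weight b d * g d))"
      using elim by (rule summable_mult)
    then have "summable (\<lambda>d. g d / ((real d + 1/2)\<^sup>2 + b\<^sup>2 / (4 * pi\<^sup>2)))"
      by (simp add: polya_gamma_weight_def)
    from suminf_mult[OF this, of "1 / (2 * pi\<^sup>2)"] show ?case
      by (simp add: polya_gamma_weight_def)
  qed
qed auto

lemma prob_space_polya_gamma: "prob_space (polya_gamma a b)"
  unfolding polya_gamma_eq_distr_series by (rule P.prob_space_distr) measurable

lemma absolutely_continuous_polya_gamma: "absolutely_continuous lborel (polya_gamma a b)"
  unfolding polya_gamma_eq_distr_series by (rule absolutely_continuous_series)

text \<open>The series has nonnegative terms, and absolute continuity excludes an atom at 0.\<close>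

lemma AE_polya_gamma_pos: "AE x in polya_gamma a b. x > 0"
proof -
  have "AE g in S. series g \<ge> 0"
    using AE_nonneg AE_summable
    by eventually_elim (auto intro!: suminf_nonneg mult_nonneg_nonneg less_imp_le[OF weight_pos])
  then have "AE x in polya_gamma a b. x \<ge> 0"
    unfolding polya_gamma_eq_distr_series by (subst AE_distr_iff) auto
  moreover have "AE x in polya_gamma a b. x \<noteq> 0"
    by (intro absolutely_continuous_AE[OF _ absolutely_continuous_polya_gamma] AE_lborel_singleton) simp
  ultimately show ?thesis by eventually_elim simp
qed

lemma density_polya_gamma_density:
  "density lborel (\<lambda>x. ennreal (polya_gamma_density a b x)) = polya_gamma a b"
proof -
  note ac = absolutely_continuous_polya_gamma
  interpret PG: prob_space "polya_gamma a b" by (rule prob_space_polya_gamma)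
  \<comment> \<open>Since \<open>enn2real\<close> sends infinity to 0, finiteness almost everywhere
    ensures that the real-valued density represents the same measure.\<close>
  have "AE x in lborel. RN_deriv lborel (polya_gamma a b) x \<noteq> \<infinity>"
    by (rule sigma_finite_measure.RN_deriv_finite[OF lborel.sigma_finite_measure_axioms _ ac]) (auto intro: PG.sigma_finite_measure_axioms)
  then have "density lborel (\<lambda>x. ennreal (polya_gamma_density a b x)) =
      density lborel (RN_deriv lborel (polya_gamma a b))"
    unfolding polya_gamma_density_def
    by (intro density_cong) (auto elim!: eventually_mono simp: less_top)
  also have "\<dots> = polya_gamma a b"
    by (rule sigma_finite_measure.density_RN_deriv[OF lborel.sigma_finite_measure_axioms ac]) simp
  finally show ?thesis .
qed

text \<open>Turns a mixture integral into an expectation; the law lives on the positive reals, so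
  the indicator of \<open>{0<..}\<close> may be inserted.\<close>

lemma set_integral_polya_gamma_density:
  fixes f :: "real \<Rightarrow> real"
  assumes [measurable]: "f \<in> borel_measurable borel"
  shows "(LBINT x:{0<..}. f x * polya_gamma_density a b x) = (\<integral>x. f x \<partial>polya_gamma a b)"
proof -
  have [measurable]: "polya_gamma_density a b \<in> borel_measurable borel"
    using borel_measurable_RN_deriv[of lborel "polya_gamma a b"]
    unfolding polya_gamma_density_def [abs_def] by simp
  have "(\<integral>x. f x \<partial>polya_gamma a b) = (\<integral>x. indicator {0<..} x * f x \<partial>polya_gamma a b)"
    using AE_polya_gamma_pos by (intro integral_cong_AE) (auto elim!: eventually_mono)
  also have "\<dots> = (\<integral>x. polya_gamma_density a b x * (indicator {0<..} x * f x) \<partial>lborel)"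
    by (subst density_polya_gamma_density[symmetric], subst integral_density)
       (auto simp: polya_gamma_density_def)
  finally show ?thesis
    by (simp add: set_lebesgue_integral_def mult_ac)
qed

lemma laplace_polya_gamma_limit:
  assumes "s \<ge> 0" and "(\<lambda>n. \<Prod>d<n. 1 + s * polya_gamma_weight b d) \<longlonglongrightarrow> L"
  shows "(\<integral>x. exp (- s * x) \<partial>polya_gamma a b) = L powr (- a)"
proof -
  have "(\<integral>x. exp (- s * x) \<partial>polya_gamma a b) = (\<integral>g. exp (- s * series g) \<partial>S)"
    unfolding polya_gamma_eq_distr_series by (rule integral_distr[OF measurable_series]) measurable
  also have "\<dots> = L powr (- a)"
    using assms by (rule laplace_series)
  finally show ?thesis .
qed

end

text \<open>With \<open>s = \<omega>\<^sup>2 / 2\<close> and \<open>b = 0\<close>, the factors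
  \<open>1 + s * w d\<close> are those of the cosh product at
  \<open>\<omega> / (2 * pi)\<close>.\<close>

lemma laplace_polya_gamma:
  assumes "a > 0"
  shows "(\<integral>x. exp (- (\<omega>\<^sup>2 / 2) * x) \<partial>polya_gamma a 0) = cosh (\<omega> / 2) powr (- a)"
proof -
  have "1 + (\<omega> / (2 * pi))\<^sup>2 / (real d + 1/2)\<^sup>2 = 1 + \<omega>\<^sup>2 / 2 * polya_gamma_weight 0 d" for d
    by (simp add: polya_gamma_weight_def power_divide power_mult_distrib)
  with cosh_product_formula_real[of "\<omega> / (2 * pi)"]
  have "(\<lambda>n. \<Prod>d<n. 1 + \<omega>\<^sup>2 / 2 * polya_gamma_weight 0 d) \<longlonglongrightarrow> cosh (\<omega> / 2)"
    by simp
  then show ?thesis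
    by (rule laplace_polya_gamma_limit[OF assms, rotated]) simp
qed

section \<open>The two mixture representations\<close>

lemma mixture_integral_polya_gamma:
  assumes "a > 0"
  shows "mixture_integral (\<lambda>_. k) (\<lambda>x. x) (polya_gamma_density a 0) \<omega> =
    exp (k * \<omega>) * cosh (\<omega> / 2) powr (- a)"
proof -
  have "mixture_integral (\<lambda>_. k) (\<lambda>x. x) (polya_gamma_density a 0) \<omega> =
      (\<integral>x. exp (k * \<omega>) * exp (- (\<omega>\<^sup>2 / 2) * x) \<partial>polya_gamma a 0)"
    unfolding mixture_integral_def using assms
    by (subst set_integral_polya_gamma_density) (simp_all add: mult.commute flip: exp_add)
  also have "\<dots> = exp (k * \<omega>) * (\<integral>x. exp (- (\<omega>\<^sup>2 / 2) * x) \<partial>polya_gamma a 0)"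
    by (rule integral_mult_right_zero)
  finally show ?thesis
    unfolding laplace_polya_gamma[OF assms] .
qed

text \<open>With \<open>u = l - y * \<omega>\<close>, the integrand is a multiple of the kernel with
  parameter \<open>(c * \<bar>u\<bar>)\<^sup>2\<close>. The factor \<open>exp (2 * c * l)\<close>
  has two sources: the normalising constant of the density gives \<open>c * l\<close>, and
  \<open>y * \<omega> = l - u\<close> gives the other \<open>c * l\<close>.\<close>

lemma mixture_integral_gig_half:
  assumes "c > 0" "l \<ge> 0" and y: "y\<^sup>2 = 1"
  shows "mixture_integral (\<lambda>x. c * y * (1 + c * l * inverse x)) (\<lambda>x. c\<^sup>2 * inverse x)
      (gig_density (1 / 2) 1 (c\<^sup>2 * l\<^sup>2)) \<omega> = exp (2 * c * l) * exp (- 2 * c * max 0 (l - y * \<omega>))"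
proof -
  let ?u = "l - y * \<omega>"
  have Z: "(LBINT t:{0<..}. gig_kernel (1/2) 1 (c\<^sup>2 * l\<^sup>2) t) = sqrt (2 * pi) * exp (- (c * l))"
    using gig_half_integral(2)[of "c * l"] assms by (simp add: power_mult_distrib)
  have kernel: "exp (c * y * (1 + c * l * inverse x) * \<omega> - c\<^sup>2 * inverse x * \<omega>\<^sup>2 / 2) *
      gig_density (1 / 2) 1 (c\<^sup>2 * l\<^sup>2) x =
      exp (c * y * \<omega>) / (sqrt (2 * pi) * exp (- (c * l))) * gig_kernel (1/2) 1 ((c * \<bar>?u\<bar>)\<^sup>2) x"
    if "x > 0" for x
  proof -
    have sq: "(c * \<bar>?u\<bar>)\<^sup>2 = c\<^sup>2 * (l\<^sup>2 - 2 * l * y * \<omega> + y\<^sup>2 * \<omega>\<^sup>2)"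
      by (simp add: power_mult_distrib) (simp add: power2_eq_square algebra_simps)
    \<comment> \<open>The term \<open>c\<^sup>2 * l * y * \<omega> / x\<close> contributed by
      \<kappa> is the cross term of the square; \<open>y\<^sup>2 = 1\<close> supplies the
      coefficient of \<open>\<omega>\<^sup>2\<close>.\<close>
    have "c * y * (1 + c * l * inverse x) * \<omega> - c\<^sup>2 * inverse x * \<omega>\<^sup>2 / 2 + - (1 * x + c\<^sup>2 * l\<^sup>2 / x) / 2 =
        c * y * \<omega> + - (1 * x + (c * \<bar>?u\<bar>)\<^sup>2 / x) / 2"
      unfolding sq y using that by (simp add: field_simps power2_eq_square)
    then have "exp (c * y * (1 + c * l * inverse x) * \<omega> - c\<^sup>2 * inverse x * \<omega>\<^sup>2 / 2) *
        exp (- (1 * x + c\<^sup>2 * l\<^sup>2 / x) / 2) = exp (c * y * \<omega>) * exp (- (1 * x + (c * \<bar>?u\<bar>)\<^sup>2 / x) / 2)"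
      by (simp only: exp_add[symmetric])
    then show ?thesis
      unfolding gig_density_def Z using that by (simp add: gig_kernel_def)
  qed
  have "mixture_integral (\<lambda>x. c * y * (1 + c * l * inverse x)) (\<lambda>x. c\<^sup>2 * inverse x)
      (gig_density (1 / 2) 1 (c\<^sup>2 * l\<^sup>2)) \<omega> =
      (LBINT x:{0<..}. exp (c * y * \<omega>) / (sqrt (2 * pi) * exp (- (c * l))) * gig_kernel (1/2) 1 ((c * \<bar>?u\<bar>)\<^sup>2) x)"
    unfolding mixture_integral_def by (intro set_lebesgue_integral_cong) (auto simp: kernel)
  also have "\<dots> = exp (c * y * \<omega>) / (sqrt (2 * pi) * exp (- (c * l))) * (sqrt (2 * pi) * exp (- (c * \<bar>?u\<bar>)))"
    using gig_half_integral(2)[of "c * \<bar>?u\<bar>"] assms by (subst set_integral_mult_right) simp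
  also have "\<dots> = exp (c * y * \<omega> + c * l - c * \<bar>?u\<bar>)"
  proof -
    have *: "exp p / (k * exp (- q)) * (k * exp (- r)) = exp (p + q - r)" if "k \<noteq> 0" for p q r k :: real
      using that by (simp add: exp_add exp_diff exp_minus divide_inverse)
    show ?thesis by (rule *) simp
  qed
  also have "c * y * \<omega> + c * l - c * \<bar>?u\<bar> = 2 * c * l + - 2 * c * max 0 ?u"
    by (simp add: max_def abs_if algebra_simps)
  finally show ?thesis by (simp only: exp_add)
qed

text \<open>Symmetrising, \<open>1 + exp \<omega> = 2 * exp (\<omega> / 2) * cosh (\<omega> /
  2)\<close>. The factor \<open>exp (\<omega> / 2)\<close> accounts for the shift of
  \<open>t\<close> by \<open>1/2\<close>, and the 2 for the constant.\<close>

lemma logistic_power_eq_cosh: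
  fixes c t \<omega> :: real
  shows "exp \<omega> powr (c * t) / (1 + exp \<omega>) powr c =
    2 powr (- c) * (exp (c * (t - 1/2) * \<omega>) * cosh (\<omega> / 2) powr (- c))"
proof -
  have two_cosh: "2 * cosh (\<omega> / 2) = exp (\<omega> / 2) + exp (- (\<omega> / 2))"
    by (simp add: cosh_field_def)
  have "1 + exp \<omega> = exp (\<omega> / 2) * (2 * cosh (\<omega> / 2))"
    unfolding two_cosh by (simp add: distrib_left mult_exp_exp)
  then have "(1 + exp \<omega>) powr c = exp (c * \<omega> / 2) * (2 powr c * cosh (\<omega> / 2) powr c)"
    by (simp add: powr_mult exp_powr_real cosh_real_nonneg mult_ac)
  moreover have "exp \<omega> powr (c * t) = exp (c * (t - 1/2) * \<omega>) * exp (c * \<omega> / 2)"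
    by (simp add: exp_powr_real algebra_simps flip: exp_add)
  ultimately show ?thesis
    by (simp add: powr_minus divide_simps)
qed

theorem lemma1:
  fixes c l :: real
  assumes "c > 0" and "l \<ge> 0"
  shows "(\<exists>C>0. \<forall>K\<ge>1. \<forall>Zi\<in>binary_vecs K. \<forall>Zj\<in>binary_vecs K. \<forall>U\<in>carrier_mat K K. \<forall>y\<in>{-1, 1}.
            phi1 c ((y + 1) / 2) Zi Zj U =
              C * mixture_integral
                    (\<lambda>x. c * ((y + 1) / 2 - 1 / 2))
                    (\<lambda>x. x)
                    (polya_gamma_density c 0)
                    (link_score Zi Zj U)) \<and>
         (\<exists>C>0. \<forall>K\<ge>1. \<forall>Zi\<in>binary_vecs K. \<forall>Zj\<in>binary_vecs K. \<forall>U\<in>carrier_mat K K. \<forall>y\<in>{-1, 1}.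
            phi2 c l y Zi Zj U =
              C * mixture_integral
                    (\<lambda>x. c * y * (1 + c * l * inverse x))
                    (\<lambda>x. c\<^sup>2 * inverse x)
                    (gig_density (1 / 2) 1 (c\<^sup>2 * l\<^sup>2))
                    (link_score Zi Zj U))"
proof (intro conjI)
  show "\<exists>C>0. \<forall>K\<ge>1. \<forall>Zi\<in>binary_vecs K. \<forall>Zj\<in>binary_vecs K. \<forall>U\<in>carrier_mat K K. \<forall>y\<in>{-1, 1}.
      phi1 c ((y + 1) / 2) Zi Zj U =
        C * mixture_integral (\<lambda>x. c * ((y + 1) / 2 - 1 / 2)) (\<lambda>x. x) (polya_gamma_density c 0)
              (link_score Zi Zj U)"
  \<comment> \<open>The witness is the constant left over by
    \<open>logistic_power_eq_cosh\<close>.\<close>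
  proof (intro exI[of _ "2 powr (- c)"] conjI allI impI ballI)
    fix K Zi Zj U and y :: real
    show "phi1 c ((y + 1) / 2) Zi Zj U =
        2 powr (- c) * mixture_integral (\<lambda>x. c * ((y + 1) / 2 - 1 / 2)) (\<lambda>x. x) (polya_gamma_density c 0)
              (link_score Zi Zj U)"
      unfolding phi1_def logistic_power_eq_cosh mixture_integral_polya_gamma[OF assms(1)] ..
  qed simp
  show "\<exists>C>0. \<forall>K\<ge>1. \<forall>Zi\<in>binary_vecs K. \<forall>Zj\<in>binary_vecs K. \<forall>U\<in>carrier_mat K K. \<forall>y\<in>{-1, 1}.
      phi2 c l y Zi Zj U =
        C * mixture_integral (\<lambda>x. c * y * (1 + c * l * inverse x)) (\<lambda>x. c\<^sup>2 * inverse x)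
              (gig_density (1 / 2) 1 (c\<^sup>2 * l\<^sup>2)) (link_score Zi Zj U)"
  \<comment> \<open>The witness cancels the factor \<open>exp (2 * c * l)\<close> of the mixture
    integral.\<close>
  proof (intro exI[of _ "exp (- (2 * c * l))"] conjI allI impI ballI)
    fix K Zi Zj U and y :: real
    assume "y \<in> {-1, 1}"
    then have "y\<^sup>2 = 1" by auto
    from mixture_integral_gig_half[OF assms this]
    show "phi2 c l y Zi Zj U =
        exp (- (2 * c * l)) * mixture_integral (\<lambda>x. c * y * (1 + c * l * inverse x)) (\<lambda>x. c\<^sup>2 * inverse x)
              (gig_density (1 / 2) 1 (c\<^sup>2 * l\<^sup>2)) (link_score Zi Zj U)"
      by (simp only: phi2_def mult.assoc[symmetric] exp_add[symmetric]) simp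
  qed simp
qed

end
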